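(* Let $\alpha\in[0,1]$, let $n=2k$ for some $k\in\mathbb{N}$, $k\ge1$, and let $\mathsf{s}_{\mathrm{pair}}=(s_1,\dots,s_n)$ with $s_{2i-1}=s_{2i}=\frac{2i-1}{2k}$ for $i\in\{1,\dots,k\}$. Let $\mathsf{f}$ be the induced client equilibrium. Then the quality of $(\mathsf{s}_{\mathrm{pair}},\mathsf{f})$ is $$Q(\mathsf{s}_{\mathrm{pair}},\mathsf{f})=\frac{2\alpha+2}{3\alpha+1}.$$
   Context: The game with parameters $n\ge 1$ and $\alpha\in[0,1]$: there are $n$ facility players $\{1,\dots,n\}$, each choosing a location $s_i\in[0,1]$; a facility location vector is $\mathsf{s}=(s_1,\dots,s_n)\in[0,1]^n$. The clients are the points $z\in[0,1]$. A client mapping is a function $\mathsf{f}:[0,1]^n\times[0,1]\to\{1,\dots,n\}$; client $z$ uses facility $\mathsf{f}(\mathsf{s},z)$. Only measurable mappings are considered: for every $\mathsf{s}$ and $i$, the set $\{z:\mathsf{f}(\mathsf{s},z)=i\}$ is a finite union of disjoint intervals; its total length is the load $\ell_i(\mathsf{s},\mathsf{f})$. The cost of client $z$ is $C_z(\mathsf{s},\mathsf{f})=(1-\alpha)|s_{\mathsf{f}(\mathsf{s},z)}-z|+\alpha\,\ell_{\mathsf{f}(\mathsf{s},z)}(\mathsf{s},\mathsf{f})$. $\mathsf{f}(\mathsf{s},\cdot)$ is a client equilibrium if for all $z\in[0,1]$ and all $j$, $(1-\alpha)|s_{\mathsf{f}(\mathsf{s},z)}-z|+\alpha\ell_{\mathsf{f}(\mathsf{s},z)}(\mathsf{s},\mathsf{f})\le(1-\alpha)|s_j-z|+\alpha\ell_j(\mathsf{s},\mathsf{f})$.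 With facilities named so that $s_1\le\dots\le s_n$, it is proper if $[0,1]$ is partitioned (up to endpoints) into consecutive intervals $[\beta_{i-1},\beta_i]$, $\beta_0=0$, $\beta_n=1$, with facility $i$ serving $[\beta_{i-1},\beta_i]$. The induced client equilibrium is the (unique) proper client equilibrium; for $\alpha=0$, where clients are indifferent between co-located facilities, co-located facilities share equally the interval of clients nearest to their common location. Social cost: $SC(\mathsf{s},\mathsf{f})=\int_0^1 C_z(\mathsf{s},\mathsf{f})\,dz$. Social optimum: $\mathrm{opt}=\min_{(\mathsf{s},\mathsf{f})}SC(\mathsf{s},\mathsf{f})$ over all location vectors and (measurable) client mappings. Quality: $Q(\mathsf{s},\mathsf{f})=SC(\mathsf{s},\mathsf{f})/\mathrm{opt}$. *)

theory Defs
  imports "HOL-Analysis.Analysis" "HOL-Combinatorics.Permutations"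
begin

text \<open>Elements of \<open>[0,1]\<^sup>n\<close> are extensional functions on the index set \<open>{1..n}\<close>.\<close>

definition location_vectors :: "nat \<Rightarrow> (nat \<Rightarrow> real) set" where
  "location_vectors n = {1..n} \<rightarrow>\<^sub>E {0..1}"

definition clients_of :: "(nat \<Rightarrow> real) \<Rightarrow> ((nat \<Rightarrow> real) \<Rightarrow> real \<Rightarrow> nat) \<Rightarrow> nat \<Rightarrow> real set" where
  "clients_of s f i = {z \<in> {0..1}. f s z = i}"

text \<open>Intervals may be empty, degenerate, open, closed or half-open.\<close>

definition finite_disjoint_interval_union :: "real set \<Rightarrow> bool" where
  "finite_disjoint_interval_union A \<longleftrightarrow>
     (\<exists>C. finite C \<and> disjoint C \<and> (\<forall>I\<in>C. is_interval I) \<and> A = \<Union>C)"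

definition client_mappings :: "nat \<Rightarrow> ((nat \<Rightarrow> real) \<Rightarrow> real \<Rightarrow> nat) set" where
  "client_mappings n = {f. \<forall>s\<in>location_vectors n.
     (\<forall>z\<in>{0..1}. f s z \<in> {1..n}) \<and>
     (\<forall>i\<in>{1..n}. finite_disjoint_interval_union (clients_of s f i))}"

definition load :: "(nat \<Rightarrow> real) \<Rightarrow> ((nat \<Rightarrow> real) \<Rightarrow> real \<Rightarrow> nat) \<Rightarrow> nat \<Rightarrow> real" where
  "load s f i = measure lborel (clients_of s f i)"

definition facility_cost ::
  "real \<Rightarrow> (nat \<Rightarrow> real) \<Rightarrow> ((nat \<Rightarrow> real) \<Rightarrow> real \<Rightarrow> nat) \<Rightarrow> nat \<Rightarrow> real \<Rightarrow> real" where
  "facility_cost \<alpha> s f j z = (1 - \<alpha>) * \<bar>s j - z\<bar> + \<alpha> * load s f j"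

definition client_cost ::
  "real \<Rightarrow> (nat \<Rightarrow> real) \<Rightarrow> ((nat \<Rightarrow> real) \<Rightarrow> real \<Rightarrow> nat) \<Rightarrow> real \<Rightarrow> real" where
  "client_cost \<alpha> s f z = facility_cost \<alpha> s f (f s z) z"

definition client_equilibrium ::
  "real \<Rightarrow> nat \<Rightarrow> (nat \<Rightarrow> real) \<Rightarrow> ((nat \<Rightarrow> real) \<Rightarrow> real \<Rightarrow> nat) \<Rightarrow> bool" where
  "client_equilibrium \<alpha> n s f \<longleftrightarrow>
     (\<forall>z\<in>{0..1}. \<forall>j\<in>{1..n}. client_cost \<alpha> s f z \<le> facility_cost \<alpha> s f j z)"

text \<open>
  The permutation \<open>p\<close> names the facilities from left to right; among co-located facilities
  any order is admitted. Clients at a common endpoint of several intervals may use any of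
  the facilities whose closed interval contains them.
\<close>

definition proper :: "nat \<Rightarrow> (nat \<Rightarrow> real) \<Rightarrow> ((nat \<Rightarrow> real) \<Rightarrow> real \<Rightarrow> nat) \<Rightarrow> bool" where
  "proper n s f \<longleftrightarrow>
     (\<exists>p \<beta>. p permutes {1..n} \<and> mono_on {1..n} (\<lambda>i. s (p i)) \<and>
        \<beta> 0 = 0 \<and> \<beta> n = 1 \<and>
        (\<forall>i\<in>{1..n}. \<beta> (i - 1) \<le> \<beta> i \<and>
           {\<beta> (i - 1)<..<\<beta> i} \<subseteq> clients_of s f (p i) \<and>
           clients_of s f (p i) \<subseteq> {\<beta> (i - 1)..\<beta> i}))"

definition nearest_clients :: "nat \<Rightarrow> (nat \<Rightarrow> real) \<Rightarrow> nat \<Rightarrow> real set" where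
  "nearest_clients n s i = {z \<in> {0..1}. \<forall>j\<in>{1..n}. \<bar>s i - z\<bar> \<le> \<bar>s j - z\<bar>}"

definition co_located :: "nat \<Rightarrow> (nat \<Rightarrow> real) \<Rightarrow> nat \<Rightarrow> nat set" where
  "co_located n s i = {j \<in> {1..n}. s j = s i}"

text \<open>
  This is a predicate since a mapping is determined only up to the choice at interval
  endpoints and the order among co-located facilities; neither affects the social cost.
  It constrains \<open>f\<close> only at the location vector \<open>s\<close>.
\<close>

definition induced_client_equilibrium ::
  "real \<Rightarrow> nat \<Rightarrow> (nat \<Rightarrow> real) \<Rightarrow> ((nat \<Rightarrow> real) \<Rightarrow> real \<Rightarrow> nat) \<Rightarrow> bool" where
  "induced_client_equilibrium \<alpha> n s f \<longleftrightarrow>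
     client_equilibrium \<alpha> n s f \<and> proper n s f \<and>
     (\<alpha> = 0 \<longrightarrow> (\<forall>i\<in>{1..n}.
        load s f i = measure lborel (nearest_clients n s i) / real (card (co_located n s i))))"

definition social_cost ::
  "real \<Rightarrow> (nat \<Rightarrow> real) \<Rightarrow> ((nat \<Rightarrow> real) \<Rightarrow> real \<Rightarrow> nat) \<Rightarrow> real" where
  "social_cost \<alpha> s f = integral {0..1} (client_cost \<alpha> s f)"

text \<open>\<open>LEAST\<close> on the reals denotes an attained minimum, not merely an infimum.\<close>

definition social_opt :: "real \<Rightarrow> nat \<Rightarrow> real" where
  "social_opt \<alpha> n =
     (LEAST c. \<exists>s\<in>location_vectors n. \<exists>f\<in>client_mappings n. c = social_cost \<alpha> s f)"

definition quality ::
  "real \<Rightarrow> nat \<Rightarrow> (nat \<Rightarrow> real) \<Rightarrow> ((nat \<Rightarrow> real) \<Rightarrow> real \<Rightarrow> nat) \<Rightarrow> real" where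
  "quality \<alpha> n s f = social_cost \<alpha> s f / social_opt \<alpha> n"

end

theory Submission
  imports Defs
begin

text \<open>
  The social cost is \<open>(1 - \<alpha>) D + \<alpha> \<Sum> l\<^sub>i\<^sup>2\<close>, where \<open>D\<close> is the total distance travelled and the
  loads \<open>l\<^sub>i\<close> sum to 1. Always \<open>\<Sum> l\<^sub>i\<^sup>2 \<ge> 1 / n\<close> and \<open>D \<ge> 1 / (4 n)\<close>, with equality in both when the
  facilities sit at the centres of \<open>n\<close> equal cells and serve these cells, so the optimum is
  \<open>(1 + 3 \<alpha>) / (4 n)\<close>. For the paired facilities \<open>D \<ge> 1 / (4 k)\<close>, hence the social cost is at
  least \<open>(1 - \<alpha>) / (4 k) + \<alpha> / n\<close>. In equilibrium this bound is attained: a client pays no more than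
  the average cost of the two facilities at the nearest location, and integrating this average
  over the \<open>k\<close> cells gives exactly the bound because the loads sum to 1. The equilibrium loads
  need not be computed.
\<close>

section \<open>Integrals of distances and of tent functions\<close>

lemma has_integral_abs_diff:
  fixes c r :: real
  assumes "0 \<le> r"
  shows "((\<lambda>z. \<bar>c - z\<bar>) has_integral r\<^sup>2) {c - r..c + r}"
proof -
  have "((\<lambda>z. c - z) has_integral (- (c - c)\<^sup>2 / 2 - (- (c - (c - r))\<^sup>2 / 2))) {c - r..c}"
    by (rule fundamental_theorem_of_calculus)
      (use assms in \<open>auto intro!: derivative_eq_intros
        simp: field_simps simp flip: has_real_derivative_iff_has_vector_derivative\<close>)
  then have left: "((\<lambda>z. \<bar>c - z\<bar>) has_integral r\<^sup>2 / 2) {c - r..c}"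
    by (subst has_integral_cong[where g = "\<lambda>z. c - z"]) auto
  have "((\<lambda>z. z - c) has_integral ((c + r - c)\<^sup>2 / 2 - (c - c)\<^sup>2 / 2)) {c..c + r}"
    by (rule fundamental_theorem_of_calculus)
      (use assms in \<open>auto intro!: derivative_eq_intros
        simp: field_simps simp flip: has_real_derivative_iff_has_vector_derivative\<close>)
  then have right: "((\<lambda>z. \<bar>c - z\<bar>) has_integral r\<^sup>2 / 2) {c..c + r}"
    by (subst has_integral_cong[where g = "\<lambda>z. z - c"]) auto
  show ?thesis
    using has_integral_combine[OF _ _ left right] assms by simp
qed

text \<open>A tent of height \<open>t\<close> over a base of width \<open>2 * t\<close> has area
  \<open>t\<^sup>2\<close>; the interval of integration may cut part of it off, hence only an
  inequality.\<close>

lemma integral_tent_le: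
  fixes c t a b :: real
  assumes "0 \<le> t"
  shows "integral {a..b} (\<lambda>z. max 0 (t - \<bar>c - z\<bar>)) \<le> t\<^sup>2"
proof -
  let ?h = "\<lambda>z. max 0 (t - \<bar>c - z\<bar>)"
  have "((\<lambda>z. t - \<bar>c - z\<bar>) has_integral (t * (2 * t) - t\<^sup>2)) {c - t..c + t}"
    using has_integral_diff[OF has_integral_const_real[of t "c - t" "c + t"]
      has_integral_abs_diff[OF assms, of c]] assms
    by (simp add: mult.commute)
  then have "(?h has_integral t\<^sup>2) {c - t..c + t}"
    by (subst has_integral_cong[where g = "\<lambda>z. t - \<bar>c - z\<bar>"]) (auto simp: power2_eq_square)
  then have tent: "(?h has_integral t\<^sup>2) UNIV"
    by (rule has_integral_on_superset) auto
  have "integral {a..b} ?h \<le> integral UNIV ?h"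
    by (rule integral_subset_le)
      (use tent in \<open>auto intro!: integrable_continuous_interval continuous_intros\<close>)
  then show ?thesis
    using tent by (simp add: integral_unique)
qed

section \<open>Partition of the unit interval into equal cells\<close>

text \<open>Rounding up makes the cells closed on the right; the \<open>max 1\<close> puts the
  client 0 into the first cell.\<close>

definition cell :: "nat \<Rightarrow> real \<Rightarrow> nat" where
  "cell k z = max 1 (nat \<lceil>real k * z\<rceil>)"

definition centre :: "nat \<Rightarrow> nat \<Rightarrow> real" where
  "centre k i = (2 * real i - 1) / (2 * real k)"

lemma cell_bounds:
  assumes "z \<in> {0..1}" "1 \<le> k"
  shows "cell k z \<in> {1..k}" "real (cell k z) - 1 \<le> real k * z" "real k * z \<le> real (cell k z)"
proof -
  have "0 \<le> real k * z" "real k * z \<le> real k"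
    using assms by (auto intro: mult_left_le)
  then show "cell k z \<in> {1..k}" "real (cell k z) - 1 \<le> real k * z" "real k * z \<le> real (cell k z)"
    using assms by (auto simp: cell_def max_def ceiling_le_iff nat_le_iff le_nat_iff) linarith+
qed

lemma cell_mono: "x \<le> y \<Longrightarrow> cell k x \<le> cell k y"
  unfolding cell_def by (intro max.mono nat_mono ceiling_mono mult_left_mono) auto

lemma cell_eq:
  assumes "1 \<le> k" "1 \<le> i" "z \<in> {(real i - 1) / real k<..<real i / real k}"
  shows "cell k z = i"
proof -
  have "real i - 1 < real k * z" "real k * z < real i"
    using assms by (auto simp: field_simps)
  then have "\<lceil>real k * z\<rceil> = int i"
    by (auto simp: ceiling_eq_iff)
  then show ?thesis
    using assms by (simp add: cell_def)
qed

lemma cell_interval_centre: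
  assumes "1 \<le> k"
  shows "{(real i - 1) / real k..real i / real k}
    = {centre k i - 1 / (2 * real k)..centre k i + 1 / (2 * real k)}"
  using assms by (auto simp: centre_def field_simps)

text \<open>Adjacent cells are glued together by induction on their number \<open>m\<close>.\<close>

lemma has_integral_cells:
  fixes g :: "nat \<Rightarrow> real \<Rightarrow> 'a::banach"
  assumes "1 \<le> k"
    and g: "\<And>i. i \<in> {1..k} \<Longrightarrow> (g i has_integral I i) {(real i - 1) / real k..real i / real k}"
  shows "((\<lambda>z. g (cell k z) z) has_integral (\<Sum>i=1..k. I i)) {0..1::real}"
proof -
  have "((\<lambda>z. g (cell k z) z) has_integral (\<Sum>i=1..m. I i)) {0..real m / real k}" if "m \<le> k" for m
    using that
  proof (induction m)
    case 0
    show ?case by (simp add: has_integral_refl)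
  next
    case (Suc m)
    \<comment> \<open>On the open cell the index is constantly \<open>Suc m\<close>; the two
      endpoints, where it may differ, do not affect the integral.\<close>
    have "((\<lambda>z. g (cell k z) z) has_integral I (Suc m)) (cbox (real m / real k) (real (Suc m) / real k))"
      by (rule has_integral_spike_interior[where f = "g (Suc m)"])
        (use g[of "Suc m"] Suc.prems cell_eq[OF \<open>1 \<le> k\<close>, of "Suc m"] in auto)
    then have "((\<lambda>z. g (cell k z) z) has_integral ((\<Sum>i=1..m. I i) + I (Suc m)))
        {0..real (Suc m) / real k}"
      using has_integral_combine[of 0 "real m / real k" "real (Suc m) / real k"] Suc
      by (simp add: divide_right_mono)
    then show ?case by simp
  qed
  from this[of k] show ?thesis
    using \<open>1 \<le> k\<close> by simp
qed

lemma has_integral_centre_distance: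
  assumes "1 \<le> k"
  shows "((\<lambda>z. \<bar>centre k i - z\<bar>) has_integral 1 / (4 * (real k)\<^sup>2))
    {(real i - 1) / real k..real i / real k}"
  using has_integral_abs_diff[of "1 / (2 * real k)" "centre k i"]
  unfolding cell_interval_centre[OF assms] by (simp add: power_divide power_mult_distrib)

lemma has_integral_cell_distance:
  assumes "1 \<le> k"
  shows "((\<lambda>z. \<bar>centre k (cell k z) - z\<bar>) has_integral 1 / (4 * real k)) {0..1}"
proof -
  have "((\<lambda>z. \<bar>centre k (cell k z) - z\<bar>) has_integral (\<Sum>i=1..k. 1 / (4 * (real k)\<^sup>2))) {0..1}"
    using has_integral_cells[where g = "\<lambda>i z. \<bar>centre k i - z\<bar>", OF assms
        has_integral_centre_distance[OF assms]] by simp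
  then show ?thesis
    using assms by (simp add: power2_eq_square)
qed

text \<open>After scaling by \<open>k\<close> the centres are the points \<open>j - 1 / 2\<close>,
  spaced 1 apart. A point is within 1/2 of the centre of its own cell, hence at least 1/2 away from
  every other centre.\<close>

lemma cell_centre_nearest:
  assumes "z \<in> {0..1}" "1 \<le> k"
  shows "\<bar>centre k (cell k z) - z\<bar> \<le> \<bar>centre k m - z\<bar>"
proof (cases "m = cell k z")
  case False
  define i where "i = cell k z"
  have scale: "\<bar>centre k j - z\<bar> = \<bar>real j - 1 / 2 - real k * z\<bar> / real k" for j
  proof -
    have "centre k j - z = (real j - 1 / 2 - real k * z) / real k"
      using assms by (simp add: centre_def field_simps)
    then show ?thesis by simp
  qed
  have "real m \<le> real i - 1 \<or> real i + 1 \<le> real m"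
    using False unfolding i_def by linarith
  then have "\<bar>real i - 1 / 2 - real k * z\<bar> \<le> \<bar>real m - 1 / 2 - real k * z\<bar>"
    using cell_bounds[OF assms] unfolding i_def by linarith
  then show ?thesis
    unfolding scale i_def by (simp add: divide_right_mono)
qed auto

section \<open>Loads, total distance and social cost of a client mapping\<close>

lemma clients_of_borel:
  assumes "f \<in> client_mappings n" "s \<in> location_vectors n" "i \<in> {1..n}"
  shows "clients_of s f i \<in> sets borel"
proof -
  obtain C where C: "finite C" "\<forall>I\<in>C. is_interval I" "clients_of s f i = \<Union> C"
    using assms unfolding client_mappings_def finite_disjoint_interval_union_def by blast
  then show ?thesis
    using sets.finite_Union[of C borel] real_interval_borel_measurable by auto
qed

text \<open>Exactly one indicator is nonzero. The finite sum replaces the dependence on the chosen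
  facility by Borel indicators, which makes measurability and integration accessible.\<close>

lemma sum_over_clients:
  fixes h :: "nat \<Rightarrow> real"
  assumes "f \<in> client_mappings n" "s \<in> location_vectors n" "z \<in> {0..1}"
  shows "h (f s z) = (\<Sum>i=1..n. indicator (clients_of s f i) z * h i)"
proof -
  have "f s z \<in> {1..n}"
    using assms unfolding client_mappings_def by blast
  moreover have "indicator (clients_of s f i) z * h i = (if i = f s z then h i else 0)" for i
    using assms by (auto simp: clients_of_def indicator_def)
  ultimately show ?thesis
    by simp
qed

text \<open>Taking \<open>w\<close> constantly 1 yields the total load; taking \<open>w\<close> to
  be the load itself yields the sum of squared loads in the social cost.\<close>

lemma has_integral_over_clients:
  fixes w :: "nat \<Rightarrow> real"
  assumes "f \<in> client_mappings n" "s \<in> location_vectors n"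
  shows "((\<lambda>z. w (f s z)) has_integral (\<Sum>i=1..n. load s f i * w i)) {0..1}"
proof -
  have "((\<lambda>z. indicator (clients_of s f i) z * w i) has_integral load s f i * w i) {0..1}"
    if "i \<in> {1..n}" for i
  proof (rule has_integral_mult_left)
    have sub: "clients_of s f i \<subseteq> {0..1}"
      by (auto simp: clients_of_def)
    have "emeasure lborel (clients_of s f i) \<le> emeasure lborel {0..1::real}"
      by (rule emeasure_mono) (use sub in auto)
    also have "\<dots> < \<infinity>"
      by simp
    finally have "((\<lambda>z. 1::real) has_integral load s f i) (clients_of s f i)"
      unfolding load_def
      by (intro has_integral_measure_lborel clients_of_borel[OF assms that]) auto
    then have "((\<lambda>z. if z \<in> clients_of s f i then 1 else 0::real) has_integral load s f i) {0..1}"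
      using sub by (simp add: has_integral_restrict)
    then show "(indicator (clients_of s f i) has_integral load s f i) {0..1}"
      by (rule has_integral_eq[rotated]) (auto simp: indicator_def)
  qed
  then have "((\<lambda>z. \<Sum>i=1..n. indicator (clients_of s f i) z * w i)
      has_integral (\<Sum>i=1..n. load s f i * w i)) {0..1}"
    by (intro has_integral_sum) auto
  then show ?thesis
    by (rule has_integral_eq[rotated]) (rule sum_over_clients[OF assms, symmetric])
qed

lemma sum_load:
  assumes "f \<in> client_mappings n" "s \<in> location_vectors n"
  shows "(\<Sum>i=1..n. load s f i) = 1"
proof -
  have "((\<lambda>z. 1::real) has_integral (\<Sum>i=1..n. load s f i)) {0..1::real}"
    using has_integral_over_clients[OF assms, of "\<lambda>_. 1"] by simp
  moreover have "((\<lambda>z. 1::real) has_integral 1) {0..1::real}"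
    using has_integral_const_real[of "1::real" 0 1] by simp
  ultimately show ?thesis
    by (rule has_integral_unique)
qed

text \<open>Cauchy-Schwarz for \<open>n\<close> loads of total 1.\<close>

lemma sum_load_squares_ge:
  assumes "f \<in> client_mappings n" "s \<in> location_vectors n" "1 \<le> n"
  shows "1 / real n \<le> (\<Sum>i=1..n. (load s f i)\<^sup>2)"
  using sum_squared_le_sum_of_squares[of "load s f" "{1..n}"] sum_load[OF assms(1,2)] assms(3)
  by (simp add: field_simps)

lemma distance_integrable:
  assumes f: "f \<in> client_mappings n" and s: "s \<in> location_vectors n"
  shows "(\<lambda>z. \<bar>s (f s z) - z\<bar>) integrable_on {0..1}"
proof -
  let ?h = "\<lambda>z. \<Sum>i=1..n. indicator (clients_of s f i) z * \<bar>s i - z\<bar>"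
  have eq: "?h z = \<bar>s (f s z) - z\<bar>" if "z \<in> {0..1}" for z
    using sum_over_clients[OF assms that, of "\<lambda>i. \<bar>s i - z\<bar>"] by simp
  have "?h \<in> borel_measurable borel"
    using clients_of_borel[OF assms]
    by (intro borel_measurable_sum borel_measurable_times borel_measurable_indicator) auto
  then have "?h \<in> borel_measurable (lebesgue_on {0..1})"
    by (intro measurable_restrict_space1 measurable_completion) simp
  then have "?h integrable_on {0..1}"
  proof (rule measurable_bounded_by_integrable_imp_integrable_real)
    show "(\<lambda>_. 1::real) integrable_on {0..1::real}"
      by (rule integrable_const_ivl)
    fix z :: real assume z: "z \<in> {0..1}"
    have "f s z \<in> {1..n}"
      using f s z unfolding client_mappings_def by blast
    then have "s (f s z) \<in> {0..1}"
      using s unfolding location_vectors_def by blast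
    then show "\<bar>?h z\<bar> \<le> 1"
      using z unfolding eq[OF z] by auto
  qed simp
  then show ?thesis
    by (rule integrable_eq) (rule eq)
qed

lemma has_integral_client_cost:
  assumes "f \<in> client_mappings n" "s \<in> location_vectors n"
  shows "(client_cost \<alpha> s f has_integral
    (1 - \<alpha>) * integral {0..1} (\<lambda>z. \<bar>s (f s z) - z\<bar>) + \<alpha> * (\<Sum>i=1..n. (load s f i)\<^sup>2)) {0..1}"
proof -
  have "client_cost \<alpha> s f = (\<lambda>z. (1 - \<alpha>) * \<bar>s (f s z) - z\<bar> + \<alpha> * load s f (f s z))"
    by (auto simp: client_cost_def facility_cost_def)
  then show ?thesis
    using has_integral_over_clients[OF assms, of "load s f"]
    by (auto intro!: has_integral_add has_integral_mult_right
        integrable_integral[OF distance_integrable[OF assms]] simp: power2_eq_square)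
qed

section \<open>Lower bounds on total distance and social cost\<close>

text \<open>
  Truncating all distances at \<open>t = 1 / (2 n)\<close>, the half-width of an optimal cell, bounds the
  distance of a client from below by a quantity that does not depend on its choice of facility.
\<close>

lemma integral_distance_ge:
  assumes f: "f \<in> client_mappings n" and s: "s \<in> location_vectors n" and "1 \<le> n"
  shows "1 / (4 * real n) \<le> integral {0..1} (\<lambda>z. \<bar>s (f s z) - z\<bar>)"
proof -
  define t where "t = 1 / (2 * real n)"
  have "0 \<le> t"
    by (simp add: t_def)
  let ?h = "\<lambda>j z. max 0 (t - \<bar>s j - z\<bar>)"
  have int: "?h j integrable_on {0..1}" for j
    by (intro integrable_continuous_interval continuous_intros)
  have int_sum: "(\<lambda>z. \<Sum>j=1..n. ?h j z) integrable_on {0..1}"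
    by (rule integrable_sum) (use int in auto)
  \<comment> \<open>The choice of \<open>t\<close> maximises \<open>t - n * t\<^sup>2\<close>, the
    bound obtained from \<open>n\<close> tents of area at most \<open>t\<^sup>2\<close>
    each.\<close>
  have "1 / (4 * real n) = t - (\<Sum>j=1..n. t\<^sup>2)"
    using \<open>1 \<le> n\<close> by (simp add: t_def field_simps power2_eq_square)
  also have "\<dots> \<le> t - (\<Sum>j=1..n. integral {0..1} (?h j))"
    by (intro diff_left_mono sum_mono integral_tent_le \<open>0 \<le> t\<close>)
  also have "\<dots> = integral {0..1} (\<lambda>z. t - (\<Sum>j=1..n. ?h j z))"
    using int int_sum by (subst integral_diff) (auto simp: integral_sum)
  also have "\<dots> \<le> integral {0..1} (\<lambda>z. \<bar>s (f s z) - z\<bar>)"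
  proof (rule integral_le)
    fix z :: real assume "z \<in> {0..1}"
    then have "f s z \<in> {1..n}"
      using f s unfolding client_mappings_def by blast
    \<comment> \<open>The tent of the facility in use is one of the summands, and subtracting it
      alone from \<open>t\<close> leaves the distance truncated at \<open>t\<close>.\<close>
    then have "?h (f s z) z \<le> (\<Sum>j=1..n. ?h j z)"
      by (intro member_le_sum) auto
    then show "t - (\<Sum>j=1..n. ?h j z) \<le> \<bar>s (f s z) - z\<bar>"
      by linarith
  qed (use int_sum distance_integrable[OF f s] in \<open>auto intro!: integrable_diff\<close>)
  finally show ?thesis .
qed

text \<open>\<open>D\<close> is left open because two bounds are inserted:
  \<open>1 / (4 * n)\<close> for arbitrary locations and \<open>1 / (4 * k)\<close> for the paired
  ones.\<close>

lemma social_cost_ge: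
  assumes "\<alpha> \<in> {0..1}" and f: "f \<in> client_mappings n" and s: "s \<in> location_vectors n" and "1 \<le> n"
    and D: "D \<le> integral {0..1} (\<lambda>z. \<bar>s (f s z) - z\<bar>)"
  shows "(1 - \<alpha>) * D + \<alpha> / real n \<le> social_cost \<alpha> s f"
proof -
  have "(1 - \<alpha>) * D + \<alpha> * (1 / real n)
      \<le> (1 - \<alpha>) * integral {0..1} (\<lambda>z. \<bar>s (f s z) - z\<bar>) + \<alpha> * (\<Sum>i=1..n. (load s f i)\<^sup>2)"
    using assms sum_load_squares_ge[OF f s \<open>1 \<le> n\<close>] by (intro add_mono mult_left_mono) auto
  then show ?thesis
    using integral_unique[OF has_integral_client_cost[OF f s, of \<alpha>]] by (simp add: social_cost_def)
qed

section \<open>An optimal solution and the value of the optimum\<close>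

text \<open>The locations are ignored, so the requirements on a client mapping hold for all location
  vectors at once.\<close>

definition cell_mapping :: "nat \<Rightarrow> (nat \<Rightarrow> real) \<Rightarrow> real \<Rightarrow> nat" where
  "cell_mapping n s z = cell n z"

lemma cell_mapping_client_mappings:
  assumes "1 \<le> n"
  shows "cell_mapping n \<in> client_mappings n"
proof -
  have "is_interval (clients_of s (cell_mapping n) i)" for s i
    unfolding is_interval_1 clients_of_def cell_mapping_def
    by (auto dest: cell_mono[where k = n] intro!: order.antisym)
  then have "finite_disjoint_interval_union (clients_of s (cell_mapping n) i)" for s i
    unfolding finite_disjoint_interval_union_def
    by (intro exI[of _ "{clients_of s (cell_mapping n) i}"]) (auto simp: pairwise_def)
  then show ?thesis
    using cell_bounds(1)[OF _ assms] by (auto simp: client_mappings_def cell_mapping_def)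
qed

text \<open>The client set lies between the open and the closed cell, which have the same length;
  this avoids distinguishing the first cell, which alone contains its left endpoint.\<close>

lemma load_cell_mapping:
  assumes "1 \<le> n" "i \<in> {1..n}" "s \<in> location_vectors n"
  shows "load s (cell_mapping n) i = 1 / real n"
proof (rule antisym)
  let ?A = "clients_of s (cell_mapping n) i"
  let ?a = "(real i - 1) / real n" and ?b = "real i / real n"
  have A: "?A \<in> sets borel"
    by (rule clients_of_borel[OF cell_mapping_client_mappings[OF assms(1)] assms(3,2)])
  have "?a \<le> ?b"
    by (simp add: divide_right_mono)
  have width: "?b - ?a = 1 / real n"
    by (simp add: diff_divide_distrib)
  have upper: "?A \<subseteq> {?a..?b}"
    using cell_bounds(2,3)[of _ n] assms
    by (auto simp: clients_of_def cell_mapping_def field_simps)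
  have finite: "{?a..?b} \<in> fmeasurable lborel"
    by (rule fmeasurableI) (use \<open>?a \<le> ?b\<close> in simp_all)
  then have "measure lborel ?A \<le> measure lborel {?a..?b}"
    using A upper by (intro measure_mono_fmeasurable) simp_all
  then show "load s (cell_mapping n) i \<le> 1 / real n"
    using \<open>?a \<le> ?b\<close> width by (simp add: load_def)
  have bounds: "?a \<ge> 0" "?b \<le> 1"
    using assms by auto
  have lower: "{?a<..<?b} \<subseteq> ?A"
  proof
    fix z assume z: "z \<in> {?a<..<?b}"
    then have "z \<in> {0..1}"
      using bounds by (simp only: atLeastAtMost_iff greaterThanLessThan_iff) linarith
    then show "z \<in> ?A"
      using cell_eq[OF _ _ z] assms by (simp add: clients_of_def cell_mapping_def)
  qed
  have "?A \<in> fmeasurable lborel"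
    by (rule fmeasurableI2[OF finite upper]) (use A in simp)
  then have "measure lborel {?a<..<?b} \<le> measure lborel ?A"
    using lower by (intro measure_mono_fmeasurable) auto
  then show "1 / real n \<le> load s (cell_mapping n) i"
    using \<open>?a \<le> ?b\<close> width by (simp add: load_def)
qed

definition centres :: "nat \<Rightarrow> nat \<Rightarrow> real" where
  "centres n = restrict (centre n) {1..n}"

lemma centres_location_vectors: "centres n \<in> location_vectors n"
  by (auto simp: centres_def centre_def location_vectors_def field_simps)

lemma social_cost_centres:
  assumes "1 \<le> n"
  shows "social_cost \<alpha> (centres n) (cell_mapping n) = (1 - \<alpha>) * (1 / (4 * real n)) + \<alpha> / real n"
proof -
  have "(client_cost \<alpha> (centres n) (cell_mapping n) has_integral
      (1 - \<alpha>) * (1 / (4 * real n)) + \<alpha> / real n) {0..1}"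
  proof (rule has_integral_eq)
    show "((\<lambda>z. (1 - \<alpha>) * \<bar>centre n (cell n z) - z\<bar> + \<alpha> / real n) has_integral
        (1 - \<alpha>) * (1 / (4 * real n)) + \<alpha> / real n) {0..1}"
      using has_integral_const_real[of "\<alpha> / real n" 0 1]
      by (intro has_integral_add has_integral_mult_right has_integral_cell_distance assms) auto
  next
    fix z :: real assume "z \<in> {0..1}"
    then have "cell n z \<in> {1..n}"
      using cell_bounds(1) assms by blast
    moreover from this have "centres n (cell n z) = centre n (cell n z)"
      by (simp add: centres_def)
    ultimately show "(1 - \<alpha>) * \<bar>centre n (cell n z) - z\<bar> + \<alpha> / real n
        = client_cost \<alpha> (centres n) (cell_mapping n) z"
      using load_cell_mapping[OF assms _ centres_location_vectors]
      by (simp add: client_cost_def facility_cost_def cell_mapping_def[of n "centres n" z])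
  qed
  then show ?thesis
    by (simp add: social_cost_def integral_unique)
qed

lemma social_opt_eq:
  assumes "\<alpha> \<in> {0..1}" "1 \<le> n"
  shows "social_opt \<alpha> n = (1 - \<alpha>) * (1 / (4 * real n)) + \<alpha> / real n"
  unfolding social_opt_def
proof (rule Least_equality)
  show "\<exists>s\<in>location_vectors n. \<exists>f\<in>client_mappings n.
      (1 - \<alpha>) * (1 / (4 * real n)) + \<alpha> / real n = social_cost \<alpha> s f"
    using centres_location_vectors cell_mapping_client_mappings[OF assms(2)]
      social_cost_centres[OF assms(2), of \<alpha>] by metis
qed (use assms social_cost_ge integral_distance_ge in blast)

section \<open>Quality of the paired facilities\<close>

lemma sum_pairs:
  fixes h :: "nat \<Rightarrow> real"
  shows "(\<Sum>i=1..k. h (2 * i - 1) + h (2 * i)) = (\<Sum>j=1..2*k. h j)"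
  by (induction k) auto

theorem theorem7:
  fixes \<alpha> :: real and n k :: nat
    and s_pair :: "nat \<Rightarrow> real"
    and f :: "(nat \<Rightarrow> real) \<Rightarrow> real \<Rightarrow> nat"
  assumes "\<alpha> \<in> {0..1}"
    and "n = 2 * k" and "k \<ge> 1"
    and "s_pair \<in> location_vectors n"
    and "\<And>i. i \<in> {1..k} \<Longrightarrow> s_pair (2 * i - 1) = (2 * real i - 1) / (2 * real k)"
    and "\<And>i. i \<in> {1..k} \<Longrightarrow> s_pair (2 * i) = (2 * real i - 1) / (2 * real k)"
    and "f \<in> client_mappings n"
    and "induced_client_equilibrium \<alpha> n s_pair f"
  shows "quality \<alpha> n s_pair f = (2 * \<alpha> + 2) / (3 * \<alpha> + 1)"
proof -
  note \<alpha> = assms(1) and s = assms(4) and f = assms(7)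
  have "1 \<le> n"
    using assms(2,3) by simp
  have pair: "s_pair (2 * i - 1) = centre k i" "s_pair (2 * i) = centre k i" if "i \<in> {1..k}" for i
    using assms(5,6)[OF that] by (simp_all add: centre_def)
  let ?l = "load s_pair f"

  have "1 / (4 * real k) \<le> integral {0..1} (\<lambda>z. \<bar>s_pair (f s_pair z) - z\<bar>)"
  proof (rule has_integral_le)
    show "((\<lambda>z. \<bar>centre k (cell k z) - z\<bar>) has_integral 1 / (4 * real k)) {0..1}"
      by (rule has_integral_cell_distance[OF assms(3)])
    show "((\<lambda>z. \<bar>s_pair (f s_pair z) - z\<bar>) has_integral
        integral {0..1} (\<lambda>z. \<bar>s_pair (f s_pair z) - z\<bar>)) {0..1}"
      by (rule integrable_integral[OF distance_integrable[OF f s]])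
    fix z :: real assume z: "z \<in> {0..1}"
    define j where "j = f s_pair z"
    have "j \<in> {1..2 * k}"
      using f s z unfolding j_def client_mappings_def assms(2) by blast
    \<comment> \<open>Facilities \<open>2 * i - 1\<close> and \<open>2 * i\<close> form pair
      \<open>i\<close>, so \<open>(j + 1) div 2\<close> is the pair of facility \<open>j\<close>.
      Every facility thus sits at a cell centre, none closer to \<open>z\<close> than the centre of
      its own cell.\<close>
    then have "(j + 1) div 2 \<in> {1..k}"
      by auto
    moreover have "j = 2 * ((j + 1) div 2) - 1 \<or> j = 2 * ((j + 1) div 2)"
      by presburger
    ultimately have "s_pair j = centre k ((j + 1) div 2)"
      using pair by metis
    then show "\<bar>centre k (cell k z) - z\<bar> \<le> \<bar>s_pair (f s_pair z) - z\<bar>"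
      using cell_centre_nearest[OF z assms(3)] by (simp add: j_def)
  qed
  from social_cost_ge[OF \<alpha> f s \<open>1 \<le> n\<close> this]
  have lower: "(1 - \<alpha>) * (1 / (4 * real k)) + \<alpha> / real n \<le> social_cost \<alpha> s_pair f" .

  \<comment> \<open>average cost for client \<open>z\<close> of the two facilities located at the centre of cell \<open>i\<close>\<close>
  define w where "w i z = (1 - \<alpha>) * \<bar>centre k i - z\<bar> + \<alpha> * ((?l (2 * i - 1) + ?l (2 * i)) / 2)" for i z
  have "(w i has_integral (1 - \<alpha>) * (1 / (4 * (real k)\<^sup>2)) + \<alpha> / real n * (?l (2 * i - 1) + ?l (2 * i)))
      {(real i - 1) / real k..real i / real k}" for i
  proof -
    have "(real i - 1) / real k \<le> real i / real k" "real i / real k - (real i - 1) / real k = 1 / real k"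
      by (simp_all add: divide_right_mono diff_divide_distrib)
    then have "((\<lambda>z. \<alpha> * ((?l (2 * i - 1) + ?l (2 * i)) / 2)) has_integral
        \<alpha> / real n * (?l (2 * i - 1) + ?l (2 * i))) {(real i - 1) / real k..real i / real k}"
      using has_integral_const_real[of "\<alpha> * ((?l (2 * i - 1) + ?l (2 * i)) / 2)"
          "(real i - 1) / real k" "real i / real k"]
      by (simp add: assms(2) mult.commute)
    then show ?thesis
      unfolding w_def
      by (intro has_integral_add has_integral_mult_right has_integral_centre_distance assms(3))
  qed
  from has_integral_cells[OF assms(3) this]
  have w: "((\<lambda>z. w (cell k z) z) has_integral
      (\<Sum>i=1..k. (1 - \<alpha>) * (1 / (4 * (real k)\<^sup>2)) + \<alpha> / real n * (?l (2 * i - 1) + ?l (2 * i)))) {0..1}" .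
  \<comment> \<open>The pairs run through all facilities exactly once, so the individual loads
    disappear into their total 1.\<close>
  have "(\<Sum>i=1..k. (1 - \<alpha>) * (1 / (4 * (real k)\<^sup>2)) + \<alpha> / real n * (?l (2 * i - 1) + ?l (2 * i)))
      = real k * ((1 - \<alpha>) * (1 / (4 * (real k)\<^sup>2))) + \<alpha> / real n * (\<Sum>j=1..2*k. ?l j)"
    by (subst sum.distrib, subst sum_distrib_left[symmetric], subst sum_pairs) simp
  also have "\<dots> = (1 - \<alpha>) * (1 / (4 * real k)) + \<alpha> / real n"
    using sum_load[OF f s] assms(2,3) by (simp add: power2_eq_square)
  finally have w: "((\<lambda>z. w (cell k z) z) has_integral (1 - \<alpha>) * (1 / (4 * real k)) + \<alpha> / real n) {0..1}"
    using w by simp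

  have "social_cost \<alpha> s_pair f \<le> (1 - \<alpha>) * (1 / (4 * real k)) + \<alpha> / real n"
  proof (rule has_integral_le)
    show "(client_cost \<alpha> s_pair f has_integral social_cost \<alpha> s_pair f) {0..1}"
      using has_integral_client_cost[OF f s] unfolding social_cost_def
      by (blast intro: integrable_integral)
    show "((\<lambda>z. w (cell k z) z) has_integral (1 - \<alpha>) * (1 / (4 * real k)) + \<alpha> / real n) {0..1}"
      by (rule w)
    fix z :: real assume z: "z \<in> {0..1}"
    define i where "i = cell k z"
    have i: "i \<in> {1..k}"
      using cell_bounds(1)[OF z assms(3)] by (simp add: i_def)
    then have "2 * i - 1 \<in> {1..n}" "2 * i \<in> {1..n}"
      by (auto simp: assms(2))
    then have "client_cost \<alpha> s_pair f z \<le> facility_cost \<alpha> s_pair f (2 * i - 1) z"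
        "client_cost \<alpha> s_pair f z \<le> facility_cost \<alpha> s_pair f (2 * i) z"
      using assms(8) z unfolding induced_client_equilibrium_def client_equilibrium_def by blast+
    \<comment> \<open>The mean of the two equilibrium inequalities; both facilities are equally far
      from \<open>z\<close>, so only the loads are averaged.\<close>
    then show "client_cost \<alpha> s_pair f z \<le> w (cell k z) z"
      unfolding i_def[symmetric] w_def facility_cost_def pair[OF i] by (simp add: field_simps)
  qed
  with lower have "social_cost \<alpha> s_pair f = (1 - \<alpha>) * (1 / (4 * real k)) + \<alpha> / real n"
    by simp
  \<comment> \<open>With \<open>n = 2 * k\<close> the cost is
    \<open>(1 + \<alpha>) / (4 * k)\<close> and the optimum
    \<open>(1 + 3 * \<alpha>) / (8 * k)\<close>.\<close>
  then show ?thesis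
    using assms(1-3) unfolding quality_def social_opt_eq[OF \<alpha> \<open>1 \<le> n\<close>]
    by (simp add: field_simps)
qed

end
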